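(* As $k\to\infty$, $$\log A(k)\le\left(\frac{2}{e}+o(1)\right)(k-1)^2 .$$ That is, for every $\varepsilon>0$ there is $k_0$ such that for all integers $k\ge k_0$ one has $\log A(k)\le\left(\frac{2}{e}+\varepsilon\right)(k-1)^2$.
   Context: A north-east lattice path is a finite path in $\mathbb{Z}^2$ starting at the origin, each of whose steps (moves) is $(1,0)$ or $(0,1)$. A path with $n$ moves has $n+1$ visited vertices (including the origin). For an integer $k\ge 2$, $A(k)$ denotes the maximum number of moves in a north-east lattice path whose visited vertices contain no $k$ collinear points, i.e. such that no line in the plane contains $k$ of the visited vertices. Here $\log$ is the natural logarithm and $e$ is its base. *)

theory Defs
  imports "HOL-Analysis.Analysis"
begin

text \<open>A path is given by the list of its visited vertices, in order.\<close>

definition ne_path :: "(int \<times> int) list \<Rightarrow> bool" where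
  "ne_path p \<longleftrightarrow> p \<noteq> [] \<and> hd p = (0, 0) \<and>
     (\<forall>i. Suc i < length p \<longrightarrow> p ! Suc i - p ! i \<in> {(1, 0), (0, 1)})"

definition moves :: "(int \<times> int) list \<Rightarrow> nat" where
  "moves p = length p - 1"

text \<open>The library predicate \<^const>\<open>collinear\<close> (all points lie on a common line) is about
  real vector spaces, so lattice points are embedded in the real plane.\<close>

definition to_plane :: "int \<times> int \<Rightarrow> real \<times> real" where
  "to_plane = map_prod real_of_int real_of_int"

definition no_k_collinear :: "nat \<Rightarrow> (int \<times> int) set \<Rightarrow> bool" where
  "no_k_collinear k V \<longleftrightarrow> \<not> (\<exists>S \<subseteq> V. card S = k \<and> collinear (to_plane ` S))"

definition move_counts :: "nat \<Rightarrow> nat set" where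
  "move_counts k = {moves p | p. ne_path p \<and> no_k_collinear k (set p)}"

text \<open>\<^const>\<open>Max\<close> is meaningful only on finite nonempty sets. For \<open>k \<ge> 2\<close> the set
  \<^term>\<open>move_counts k\<close> contains 0 (the one-vertex path); its finiteness is a genuine fact,
  to be asserted alongside any bound on \<open>max_moves\<close>.\<close>

definition max_moves :: "nat \<Rightarrow> nat" where
  "max_moves k = Max (move_counts k)"

end

theory Submission
  imports Defs "HOL-Real_Asymp.Real_Asymp"
begin

text \<open>
  Put \<open>K = k - 1\<close> and let \<open>y t\<close> be the height of the path after \<open>t\<close> moves. For a fraction \<open>b / m\<close>
  the integer \<open>m y t - b t\<close> determines the line of slope \<open>b / (m - b)\<close> through the point at time
  \<open>t\<close>, so it takes each value at most \<open>K\<close> times and hence oscillates by about \<open>N / K\<close> on every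
  time interval of length \<open>N\<close>. Let \<open>\<beta>\<close> be the mean of the increments of \<open>y\<close> on such an interval.
  Choosing \<open>b / m\<close> close to \<open>\<beta>\<close>, one finds that \<open>y t - \<beta> t\<close>, which has equal values
  at both ends, oscillates by about \<open>N / (2 K\<^sup>2)\<close>; so some subinterval of length \<open>l\<close> has mean
  \<open>\<beta> + w\<close> with \<open>w l \<ge> c N\<close>, where \<open>c \<approx> 1 / (4 K\<^sup>2)\<close>. Since \<open>ln (N / l) \<le> ln (w / c) \<le> w / (e c)\<close>,
  iterating raises the mean at a cost of at most \<open>1 / (e c)\<close> in the logarithm of the length per unit
  of mean. The mean never exceeds 1, and by the symmetry exchanging the axes it may be assumed to
  start at 1/2 or above, which leaves \<open>ln n \<le> 1 / (2 e c)\<close> up to lower order terms.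
\<close>

subsection \<open>Rational approximation\<close>

text \<open>
  Refine a Farey pair around \<open>\<beta>\<close> by mediants until the denominators satisfy
  \<open>(K - q) (K - q') \<le> 0\<close>: if both fractions violated the bound, adding the two violations
  would give \<open>(K - q) (K - q') > 0\<close>.
\<close>

lemma farey_pair_approximation:
  fixes \<beta> :: real and K p q p' q' :: int
  assumes "0 < q" "0 < q'" "q \<le> K \<or> q' \<le> K" "p' * q - p * q' = 1"
    and "p \<le> q * \<beta>" "q' * \<beta> \<le> p'"
  shows "\<exists>m b :: int. m > 0 \<and> 2 * K\<^sup>2 * \<bar>m * \<beta> - b\<bar> \<le> 2 * K - m"
  using assms
\<comment> \<open>While both denominators are below \<open>K\<close>, their sum is below
  \<open>2 * K\<close>, so each mediant lowers this measure.\<close>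
proof (induction "nat (2 * K - q - q')" arbitrary: p q p' q' rule: less_induct)
  case less
  show ?case
  proof (cases "q < K \<and> q' < K")
    case True
    show ?thesis
    proof (cases "p + p' \<le> (q + q') * \<beta>")
      case True
      then show ?thesis
        using less.prems(1,2,4,6) \<open>q < K \<and> q' < K\<close>
        by (intro less.hyps[of "q + q'" q' p' "p + p'"]) (simp_all add: distrib_left distrib_right)
    next
      case False
      then show ?thesis
        using less.prems(1,2,4,5) \<open>q < K \<and> q' < K\<close>
        by (intro less.hyps[of q "q + q'" "p + p'" p]) (simp_all add: distrib_left distrib_right)
    qed
  next
    case False
    then have "(K - q) * (K - q') \<le> 0"
      using less.prems by (auto simp: mult_le_0_iff)
    then have *: "(real_of_int K - q) * (real_of_int K - q') \<le> 0"
      by (metis of_int_0_le_iff of_int_diff of_int_le_0_iff of_int_mult)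
    have det: "real_of_int p' * q - p * q' = 1"
      using less.prems(4) by (metis of_int_1 of_int_diff of_int_mult)
    have "2 * K\<^sup>2 * \<bar>q * \<beta> - p\<bar> \<le> 2 * K - q \<or> 2 * K\<^sup>2 * \<bar>q' * \<beta> - p'\<bar> \<le> 2 * K - q'"
    proof (rule ccontr)
      assume "\<not> ?thesis"
      then have "2 * K\<^sup>2 * (q * \<beta> - p) > 2 * K - q" "2 * K\<^sup>2 * (p' - q' * \<beta>) > 2 * K - q'"
        using less.prems by auto
      \<comment> \<open>The weights \<open>q'\<close> and \<open>q\<close> cancel \<beta> and leave
        the determinant 1.\<close>
      then have "q' * (2 * K\<^sup>2 * (q * \<beta> - p)) > q' * (2 * K - q)"
        "q * (2 * K\<^sup>2 * (p' - q' * \<beta>)) > q * (2 * K - q')"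
        using less.prems(1,2) by (simp_all only: mult_strict_left_mono of_int_mult of_int_0_less_iff)
      then have "q' * (2 * K - q) + q * (2 * K - q') < 2 * K\<^sup>2 * (real_of_int p' * q - p * q')"
        by (simp add: algebra_simps)
      with det * show False
        by (simp add: algebra_simps power2_eq_square)
    qed
    then show ?thesis
      using less.prems(1,2) by blast
  qed
qed

text \<open>The term \<open>- m\<close> on the right is essential: it leaves a gain proportional to
  \<open>m\<close>, hence, after division by \<open>m\<close>, one independent of the
  fraction.\<close>

lemma sharp_dirichlet_approximation:
  fixes \<beta> :: real and K :: int
  assumes "K \<ge> 1"
  obtains m b :: int where "m > 0" "2 * K\<^sup>2 * \<bar>m * \<beta> - b\<bar> \<le> 2 * K - m"
proof -
  have "\<beta> \<le> of_int (\<lfloor>\<beta>\<rfloor> + 1)" by linarith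
  then have "\<exists>m b :: int. m > 0 \<and> 2 * K\<^sup>2 * \<bar>m * \<beta> - b\<bar> \<le> 2 * K - m"
    using assms by (intro farey_pair_approximation[of 1 1 K "\<lfloor>\<beta>\<rfloor> + 1" "\<lfloor>\<beta>\<rfloor>"]) simp_all
  then show ?thesis using that by blast
qed

subsection \<open>Oscillation of the height\<close>

text \<open>As \<open>t\<close> is the sum of the coordinates, exchanging the axes only replaces
  \<open>b\<close> by \<open>m - b\<close>. With \<open>m = 0\<close> the lines would be
  antidiagonals, which a path meets at most once.\<close>

definition line_bounded :: "nat \<Rightarrow> nat \<Rightarrow> (nat \<Rightarrow> int) \<Rightarrow> bool" where
  "line_bounded K n y \<longleftrightarrow>
     (\<forall>m b v. m > 0 \<longrightarrow> card {t \<in> {..n}. m * y t - b * int t = v} \<le> K)"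

definition unit_steps :: "nat \<Rightarrow> (nat \<Rightarrow> int) \<Rightarrow> bool" where
  "unit_steps n y \<longleftrightarrow> (\<forall>t<n. y (Suc t) - y t \<in> {0, 1})"

text \<open>Pigeonhole: each of the \<open>f v - f u + 1\<close> integers between the extreme values
  is taken at most \<open>K\<close> times.\<close>

lemma large_oscillation:
  fixes f :: "'a \<Rightarrow> int"
  assumes fin: "finite A" "A \<noteq> {}"
    and fib: "\<And>v. card {t \<in> A. f t = v} \<le> K"
  obtains u v where "u \<in> A" "v \<in> A" "int (card A) \<le> int K * (f v - f u + 1)"
proof -
  obtain u where u: "u \<in> A" "\<And>t. t \<in> A \<Longrightarrow> f u \<le> f t"
    using fin by (metis arg_min_if_finite(1) arg_min_least)
  obtain v where v: "v \<in> A" "\<And>t. t \<in> A \<Longrightarrow> f t \<le> f v"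
    using finite_has_maximal[of "f ` A"] fin by (smt (verit) finite_imageI imageE imageI image_is_empty)
  have "A = (\<Union>z\<in>{f u..f v}. {t \<in> A. f t = z})"
    using u v by auto
  then have "card A = card (\<Union>z\<in>{f u..f v}. {t \<in> A. f t = z})"
    by (rule arg_cong)
  also have "\<dots> \<le> (\<Sum>z\<in>{f u..f v}. card {t \<in> A. f t = z})"
    by (rule card_UN_le) simp
  also have "\<dots> \<le> card {f u..f v} * K"
    using sum_bounded_above[of "{f u..f v}" "\<lambda>z. card {t \<in> A. f t = z}" K] fib by simp
  also have "\<dots> = nat (f v - f u + 1) * K" by simp
  finally have "int (card A) \<le> int (nat (f v - f u + 1) * K)"
    by (simp only: of_nat_le_iff)
  then have "int (card A) \<le> int K * (f v - f u + 1)"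
    using u(2)[OF v(1)] by (simp add: algebra_simps)
  then show ?thesis using that u v by blast
qed

lemma subinterval_gain:
  fixes y :: "nat \<Rightarrow> int" and \<beta> :: real
  assumes lb: "line_bounded K n y" and "K \<ge> 1" "i \<le> j" "j \<le> n"
    and \<beta>: "y j - y i = \<beta> * (real j - real i)"
  obtains u v where "i \<le> u" "u \<le> v" "v \<le> j"
    "y v - y u - \<beta> * (real v - real u) \<ge> (real j - real i) / (4 * real K ^ 2) - 1"
proof -
  let ?g = "\<lambda>t. y t - \<beta> * real t" and ?N = "real j - real i"
  obtain m b :: int where m: "m > 0" and mb: "2 * (int K)\<^sup>2 * \<bar>m * \<beta> - b\<bar> \<le> 2 * int K - m"
    using sharp_dirichlet_approximation[of "int K" \<beta>] \<open>K \<ge> 1\<close> by auto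
  have "card {t \<in> {i..j}. m * y t - b * int t = v} \<le> K" for v
  proof -
    have "card {t \<in> {i..j}. m * y t - b * int t = v} \<le> card {t \<in> {..n}. m * y t - b * int t = v}"
      using \<open>j \<le> n\<close> by (intro card_mono) auto
    also have "\<dots> \<le> K" using lb m unfolding line_bounded_def by blast
    finally show ?thesis .
  qed
  then obtain u v where uv: "u \<in> {i..j}" "v \<in> {i..j}"
    and "int (card {i..j}) \<le> int K * ((m * y v - b * int v) - (m * y u - b * int u) + 1)"
    using large_oscillation[of "{i..j}" "\<lambda>t. m * y t - b * int t" K] \<open>i \<le> j\<close> by auto
  then have "real_of_int (int (card {i..j})) \<le>
      of_int (int K * ((m * y v - b * int v) - (m * y u - b * int u) + 1))"
    by (simp only: of_int_le_iff)
  then have osc: "?N \<le> real K * (m * (y v - y u) - b * (real v - real u) + 1)"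
    using \<open>i \<le> j\<close> by (simp add: algebra_simps)
  have K: "real K > 0" using \<open>K \<ge> 1\<close> by simp
  \<comment> \<open>This bounds the error of replacing \<open>b\<close> by
    \<open>m * \<beta>\<close>; of the oscillation \<open>?N / K\<close> there remains
    \<open>m * (?N / (2 * real K ^ 2))\<close>.\<close>
  have "\<bar>(m * \<beta> - b) * (real v - real u)\<bar> \<le> \<bar>m * \<beta> - b\<bar> * ?N"
    unfolding abs_mult using uv by (intro mult_left_mono) auto
  also have "\<dots> \<le> (2 * real K - m) / (2 * real K ^ 2) * ?N"
    using mb K \<open>i \<le> j\<close> by (intro mult_right_mono) (auto simp: field_simps)
  also have "\<dots> = ?N / K - m * (?N / (2 * real K ^ 2))"
    using K by (simp add: field_simps power2_eq_square)
  finally have "\<bar>(m * \<beta> - b) * (real v - real u)\<bar> \<le> ?N / K - m * (?N / (2 * real K ^ 2))" .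
  moreover have "?N / K \<le> m * (y v - y u) - b * (real v - real u) + 1"
    using osc K by (simp add: field_simps)
  ultimately have "m * (?N / (2 * real K ^ 2)) - 1 \<le> m * (?g v - ?g u)"
    by (simp add: algebra_simps abs_le_iff)
  then have "real_of_int m * (?N / (2 * real K ^ 2) - 1) \<le> m * (?g v - ?g u)"
    using m by (simp add: algebra_simps)
  then have range: "?N / (2 * real K ^ 2) - 1 \<le> ?g v - ?g u"
    using m by (simp only: mult_le_cancel_left_pos of_int_0_less_iff)
  have ends: "?g i = ?g j" using \<beta> by (simp add: algebra_simps)
  have half: "?N / (2 * real K ^ 2) = 2 * (?N / (4 * real K ^ 2))"
    using K by (simp add: field_simps)
  have pos: "?N / (4 * real K ^ 2) \<ge> 0" using \<open>i \<le> j\<close> by simp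
  \<comment> \<open>If \<open>v < u\<close>, equal end values give
    \<open>?g v - ?g u = (?g v - ?g i) + (?g j - ?g u)\<close>, so one of the two rises is at least
    half of the total.\<close>
  consider "u \<le> v" | "v < u" "?g v - ?g i \<ge> ?N / (4 * real K ^ 2) - 1"
    | "v < u" "?g j - ?g u \<ge> ?N / (4 * real K ^ 2) - 1"
    using range half ends by linarith
  then show ?thesis
  proof cases
    case 1
    then show ?thesis using that[of u v] uv range half pos by (simp add: algebra_simps)
  next
    case 2
    then show ?thesis using that[of i v] uv by (simp add: algebra_simps)
  next
    case 3
    then show ?thesis using that[of u j] uv by (simp add: algebra_simps)
  qed
qed

subsection \<open>Iterating towards steeper intervals\<close>

text \<open>The line \<open>x / exp 1\<close> is the tangent to ln at e; the factor 1/e of the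
  theorem comes from here.\<close>

lemma ln_le_divide_exp_one:
  fixes x :: real
  assumes "x > 0"
  shows "ln x \<le> x / exp 1"
  using ln_le_minus_one[of "x / exp 1"] assms by (simp add: ln_div)

lemma unit_steps_le:
  assumes "unit_steps n y" "i \<le> j" "j \<le> n"
  shows "y j - y i \<le> int (j - i)"
  using assms(2,3)
proof (induction j rule: dec_induct)
  case (step j)
  then have "y (Suc j) - y j \<in> {0, 1}"
    using assms(1) unfolding unit_steps_def by simp
  with step show ?case by (auto simp: Suc_diff_le)
qed simp

text \<open>With \<open>L\<close> the coefficient of \<open>1 - \<beta>\<close>, the sum of the log
  length and \<open>L\<close> times the mean never decreases along the iteration. Once the length is
  below \<open>4 * real K ^ 3\<close>, a mean of at most 1 suffices.\<close>

lemma ln_length_le_slope_deficit: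
  fixes y :: "nat \<Rightarrow> int" and \<beta> :: real
  assumes lb: "line_bounded K n y" and us: "unit_steps n y" and K: "K \<ge> 2"
    and "i < j" "j \<le> n" "y j - y i = \<beta> * (real j - real i)"
  shows "ln (real j - real i) \<le>
    4 * real K ^ 3 / (exp 1 * (real K - 1)) * (1 - \<beta>) + ln (4 * real K ^ 3)"
  using assms(4-)
proof (induction "j - i" arbitrary: i j \<beta> rule: less_induct)
  case less
  let ?N = "real j - real i" and ?L = "4 * real K ^ 3 / (exp 1 * (real K - 1))"
  have N: "?N > 0" using less.prems by simp
  have lam: "?L > 0" using K by simp
  have "y j - y i \<le> ?N"
    using unit_steps_le[OF us, of i j] less.prems by linarith
  then have b1: "\<beta> \<le> 1"
    using less.prems(3) N by (metis mult.commute mult.right_neutral mult_le_cancel_left_pos)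
  show ?case
  proof (cases "?N < 4 * real K ^ 3")
    case True
    then have "ln ?N \<le> ln (4 * real K ^ 3)" using N by (intro ln_mono) auto
    moreover have "?L * (1 - \<beta>) \<ge> 0" using lam b1 by (intro mult_nonneg_nonneg) auto
    ultimately show ?thesis by linarith
  next
    case False
    \<comment> \<open>This is 1/(4K^2) - 1/(4K^3): the part given up absorbs the loss of 1 in the
      gain once \<open>?N\<close> is at least 4K^3.\<close>
    define c where "c = (real K - 1) / (4 * real K ^ 3)"
    have c: "c > 0" unfolding c_def using K by simp
    have lamc: "?L = 1 / (exp 1 * c)" unfolding c_def by simp
    obtain u v where uv: "i \<le> u" "u \<le> v" "v \<le> j" and
      gain: "y v - y u - \<beta> * (real v - real u) \<ge> ?N / (4 * real K ^ 2) - 1"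
      using subinterval_gain[OF lb, of i j \<beta>] less.prems K by auto
    let ?l = "real v - real u"
    have "?N / (4 * real K ^ 2) - 1 - c * ?N = (?N - 4 * real K ^ 3) / (4 * real K ^ 3)"
      unfolding c_def using K by (simp add: field_simps power2_eq_square power3_eq_cube)
    also have "\<dots> \<ge> 0" using False by simp
    finally have gain': "y v - y u - \<beta> * ?l \<ge> c * ?N" using gain by linarith
    have cN: "c * ?N > 0" using c N by simp
    have "u < v" using gain' cN uv by (cases "u = v") auto
    \<comment> \<open>The whole interval has mean \<beta>, hence gain 0.\<close>
    moreover have "\<not> (u = i \<and> v = j)" using gain' cN less.prems(3) by auto
    ultimately have small: "v - u < j - i" using uv by linarith
    have l: "?l > 0" using \<open>u < v\<close> by simp
    define w where "w = (y v - y u) / ?l - \<beta>"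
    have wl: "w * ?l = y v - y u - \<beta> * ?l"
      unfolding w_def using l by (simp add: field_simps)
    have IH: "ln ?l \<le> ?L * (1 - (\<beta> + w)) + ln (4 * real K ^ 3)"
      using less.hyps[OF small \<open>u < v\<close>, of "\<beta> + w"] uv less.prems(2) l by (simp add: w_def)
    have "ln ?N - ln ?l = ln (?N / ?l)" using N l by (simp add: ln_div)
    also have "\<dots> \<le> ln (w / c)"
    proof (rule ln_mono)
      have "x / z \<le> w' / c" if "c * x \<le> w' * z" "z > 0" for x z w' :: real
        using that c by (simp add: field_simps)
      then show "?N / ?l \<le> w / c" using gain' wl l by metis
    qed (use N l in auto)
    also have "\<dots> \<le> ?L * w"
    proof -
      have "w > 0" using gain' cN wl l by (metis less_le_trans zero_less_mult_pos2)
      then show ?thesis using ln_le_divide_exp_one[of "w / c"] c unfolding lamc by (simp add: field_simps)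
    qed
    finally have "ln ?N - ln ?l \<le> ?L * w" .
    moreover have "?L * (1 - \<beta>) = ?L * (1 - (\<beta> + w)) + ?L * w"
      by (simp only: distrib_left[symmetric]) simp
    ultimately show ?thesis using IH by linarith
  qed
qed

lemma ln_moves_le_of_line_bounded:
  assumes lb: "line_bounded K n y" and us: "unit_steps n y" and "K \<ge> 2" "n > 0"
  shows "ln (real n) \<le> 2 * real K ^ 3 / (exp 1 * (real K - 1)) + ln (4 * real K ^ 3)"
proof -
  let ?L = "4 * real K ^ 3 / (exp 1 * (real K - 1))"
  have bound: "ln (real n) \<le> ?L / 2 + ln (4 * real K ^ 3)"
    if "line_bounded K n z" "unit_steps n z" "2 * (z n - z 0) \<ge> int n" for z
  proof -
    let ?\<beta> = "(z n - z 0) / real n"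
    have "ln (real n) \<le> ?L * (1 - ?\<beta>) + ln (4 * real K ^ 3)"
      using ln_length_le_slope_deficit[OF that(1,2) \<open>K \<ge> 2\<close>, of 0 n ?\<beta>] \<open>n > 0\<close> by simp
    moreover have "2 * real_of_int (z n - z 0) \<ge> real n" using that(3) by linarith
    then have "?\<beta> \<ge> 1 / 2" using \<open>n > 0\<close> by (simp add: field_simps)
    then have "?L * (1 - ?\<beta>) \<le> ?L * (1 / 2)"
      using \<open>K \<ge> 2\<close> by (intro mult_left_mono) auto
    ultimately show ?thesis by simp
  qed
  have "ln (real n) \<le> ?L / 2 + ln (4 * real K ^ 3)"
  proof (cases "2 * (y n - y 0) \<ge> int n")
    case True
    then show ?thesis using bound lb us by blast
  next
    case False
    \<comment> \<open>The number of horizontal moves: if fewer than half of the moves go up, more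
      than half go right.\<close>
    let ?x = "\<lambda>t. int t - y t"
    have "m * ?x t - b * int t = v \<longleftrightarrow> m * y t - (m - b) * int t = - v" for m b v t
      by (auto simp: algebra_simps)
    then have "line_bounded K n ?x"
      using lb unfolding line_bounded_def by presburger
    moreover have "unit_steps n ?x"
      using us unfolding unit_steps_def by force
    ultimately show ?thesis using bound[of ?x] False by simp
  qed
  then show ?thesis by simp
qed

subsection \<open>Lattice paths\<close>

lemma ne_path_coord_sum:
  assumes "ne_path p" "i < length p"
  shows "fst (p ! i) + snd (p ! i) = int i"
  using assms(2)
proof (induction i)
  case 0
  then show ?case using assms(1) by (simp add: ne_path_def hd_conv_nth)
next
  case (Suc i)
  then have "p ! Suc i - p ! i \<in> {(1, 0), (0, 1)}"
    using assms(1) by (simp add: ne_path_def)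
  then have "fst (p ! Suc i) + snd (p ! Suc i) = fst (p ! i) + snd (p ! i) + 1"
    by (auto simp: prod_eq_iff)
  with Suc show ?case by simp
qed

lemma unit_steps_ne_path:
  assumes "ne_path p"
  shows "unit_steps (moves p) (\<lambda>t. snd (p ! t))"
  unfolding unit_steps_def
proof (intro allI impI)
  fix t assume "t < moves p"
  then have "p ! Suc t - p ! t \<in> {(1, 0), (0, 1)}"
    using assms by (simp add: ne_path_def moves_def)
  then show "snd (p ! Suc t) - snd (p ! t) \<in> {0, 1}"
    by (auto simp: prod_eq_iff)
qed

lemma line_bounded_ne_path:
  assumes p: "ne_path p" and nc: "no_k_collinear (Suc K) (set p)"
  shows "line_bounded K (moves p) (\<lambda>t. snd (p ! t))"
  unfolding line_bounded_def
proof (intro allI impI)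
  fix m b v :: int
  assume m: "m > 0"
  let ?T = "{t \<in> {..moves p}. m * snd (p ! t) - b * int t = v}"
  show "card ?T \<le> K"
  proof (rule ccontr)
    assume "\<not> card ?T \<le> K"
    then have "Suc K \<le> card ?T" by simp
    then obtain T where T: "T \<subseteq> ?T" "card T = Suc K"
      by (rule obtain_subset_with_card_n)
    have len: "t < length p" if "t \<in> T" for t
    proof -
      have "t \<le> moves p" "p \<noteq> []" using that T(1) p by (auto simp: ne_path_def)
      then show ?thesis by (cases p) (auto simp: moves_def)
    qed
    have sum: "fst (p ! t) + snd (p ! t) = int t" if "t \<in> T" for t
      using ne_path_coord_sum[OF p] len that by blast
    \<comment> \<open>The coordinate sum recovers the time, so distinct times give distinct
      vertices.\<close>
    have "inj_on ((!) p) T"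
      by (rule inj_onI) (metis sum of_nat_eq_iff)
    then have "card ((!) p ` T) = Suc K" using T(2) by (simp add: card_image)
    moreover have "(!) p ` T \<subseteq> set p" using len by auto
    moreover have "collinear (to_plane ` (!) p ` T)"
      unfolding collinear_def
    proof (intro exI[of _ "(real_of_int (m - b), real_of_int b)"] ballI)
      fix x y
      assume "x \<in> to_plane ` (!) p ` T" "y \<in> to_plane ` (!) p ` T"
      then obtain s t where st: "s \<in> T" "t \<in> T" "x = to_plane (p ! s)" "y = to_plane (p ! t)"
        by auto
      let ?dy = "snd (p ! s) - snd (p ! t)" and ?dx = "fst (p ! s) - fst (p ! t)"
        and ?dt = "int s - int t"
      have "m * snd (p ! s) - b * int s = m * snd (p ! t) - b * int t"
        using T(1) st(1,2) by auto
      then have dy: "m * ?dy = b * ?dt" by (simp add: algebra_simps)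
      moreover have dxy: "?dx = ?dt - ?dy" using sum[of s] sum[of t] st by linarith
      ultimately have dx: "m * ?dx = (m - b) * ?dt" by (simp only: dxy) (simp add: algebra_simps)
      have "real_of_int m * ?dy = b * ?dt" "real_of_int m * ?dx = (m - b) * ?dt"
        using dx dy by (metis of_int_mult)+
      then have "real_of_int ?dy = ?dt / m * b" "real_of_int ?dx = ?dt / m * (m - b)"
        using m by (simp_all add: field_simps)
      then show "\<exists>c. x - y = c *\<^sub>R (real_of_int (m - b), real_of_int b)"
        using st by (intro exI[of _ "?dt / m"]) (auto simp: to_plane_def prod_eq_iff)
    qed
    ultimately show False using nc unfolding no_k_collinear_def by blast
  qed
qed

lemma ln_move_counts_le:
  assumes "n \<in> move_counts (Suc K)" "n > 0" "K \<ge> 2"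
  shows "ln (real n) \<le> 2 * real K ^ 3 / (exp 1 * (real K - 1)) + ln (4 * real K ^ 3)"
  using assms ln_moves_le_of_line_bounded line_bounded_ne_path unit_steps_ne_path
  unfolding move_counts_def by blast

lemma move_counts_mono:
  assumes "k \<le> k'"
  shows "move_counts k \<subseteq> move_counts k'"
proof -
  have "no_k_collinear k' V" if nc: "no_k_collinear k V" for V
    unfolding no_k_collinear_def
  proof
    assume "\<exists>S\<subseteq>V. card S = k' \<and> collinear (to_plane ` S)"
    then obtain S where S: "S \<subseteq> V" "card S = k'" "collinear (to_plane ` S)" by blast
    obtain S' where "S' \<subseteq> S" "card S' = k"
      using obtain_subset_with_card_n[of k S] assms S(2) by metis
    moreover from this have "collinear (to_plane ` S')"
      using S(3) by (meson collinear_subset image_mono)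
    ultimately show False
      using nc S(1) unfolding no_k_collinear_def by blast
  qed
  then show ?thesis unfolding move_counts_def by blast
qed

lemma finite_move_counts: "finite (move_counts k)"
proof -
  \<comment> \<open>The logarithmic bound requires \<open>K \<ge> 2\<close>; monotonicity carries
    finiteness down to smaller \<open>k\<close>.\<close>
  let ?K = "max k 2"
  let ?B = "2 * real ?K ^ 3 / (exp 1 * (real ?K - 1)) + ln (4 * real ?K ^ 3)"
  have "n \<le> nat \<lceil>exp ?B\<rceil>" if "n \<in> move_counts (Suc ?K)" for n
  proof (cases "n = 0")
    case False
    then have "ln (real n) \<le> ?B"
      by (intro ln_move_counts_le[OF that]) simp_all
    then have "exp (ln (real n)) \<le> exp ?B" by (simp only: exp_le_cancel_iff)
    then have "real n \<le> exp ?B" using False by simp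
    then show ?thesis by linarith
  qed simp
  then have "finite (move_counts (Suc ?K))"
    by (meson finite_nat_set_iff_bounded_le)
  then show ?thesis
    by (rule finite_subset[rotated]) (simp add: move_counts_mono)
qed

lemma max_moves_mem:
  assumes "k \<ge> 2"
  shows "max_moves k \<in> move_counts k"
proof -
  have "no_k_collinear k (set [(0, 0)])"
    unfolding no_k_collinear_def
  proof
    assume "\<exists>S\<subseteq>set [(0, 0)]. card S = k \<and> collinear (to_plane ` S)"
    then obtain S :: "(int \<times> int) set" where "S \<subseteq> {(0, 0)}" "card S = k" by auto
    then show False using assms card_mono[of "{(0, 0)}" S] by simp
  qed
  moreover have "ne_path [(0, 0)]" by (simp add: ne_path_def)
  ultimately have "move_counts k \<noteq> {}"
    unfolding move_counts_def by blast
  then show ?thesis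
    unfolding max_moves_def using finite_move_counts by simp
qed

theorem theorem1p1:
  shows "(\<forall>k\<ge>2. finite (move_counts k)) \<and>
    (\<forall>\<epsilon>::real. \<epsilon> > 0 \<longrightarrow> (\<exists>k0::nat. \<forall>k\<ge>k0.
       ln (real (max_moves k)) \<le> (2 / exp 1 + \<epsilon>) * (real k - 1)\<^sup>2))"
proof (intro conjI allI impI)
  fix \<epsilon> :: real
  assume "\<epsilon> > 0"
  \<comment> \<open>The first term is asymptotic to 2x^2/e, and the logarithm is negligible against
    x^2.\<close>
  have "((\<lambda>x::real. (2 * x ^ 3 / (exp 1 * (x - 1)) + ln (4 * x ^ 3)) / x\<^sup>2) \<longlongrightarrow> 2 / exp 1) at_top"
    by (real_asymp simp: field_simps)
  then have "\<forall>\<^sub>F x::real in at_top.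
      (2 * x ^ 3 / (exp 1 * (x - 1)) + ln (4 * x ^ 3)) / x\<^sup>2 < 2 / exp 1 + \<epsilon>"
    using \<open>\<epsilon> > 0\<close> by (intro order_tendstoD(2)) auto
  then obtain X where X: "\<And>x::real. x \<ge> X \<Longrightarrow>
      (2 * x ^ 3 / (exp 1 * (x - 1)) + ln (4 * x ^ 3)) / x\<^sup>2 < 2 / exp 1 + \<epsilon>"
    by (auto simp: eventually_at_top_linorder)
  show "\<exists>k0. \<forall>k\<ge>k0. ln (real (max_moves k)) \<le> (2 / exp 1 + \<epsilon>) * (real k - 1)\<^sup>2"
  proof (intro exI allI impI)
    fix k :: nat
    \<comment> \<open>The shift from \<open>k\<close> to \<open>K = k - 1\<close> accounts for 3 and
      for the added 1.\<close>
    assume k: "k \<ge> max 3 (nat \<lceil>X\<rceil> + 1)"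
    define K where "K = k - 1"
    have K: "K \<ge> 2" "k = Suc K" using k by (auto simp: K_def)
    have KX: "real K \<ge> X" using k unfolding K_def by linarith
    show "ln (real (max_moves k)) \<le> (2 / exp 1 + \<epsilon>) * (real k - 1)\<^sup>2"
    proof (cases "max_moves k = 0")
      \<comment> \<open>Here the default value \<open>ln 0 = 0\<close> applies.\<close>
      case True
      then show ?thesis using \<open>\<epsilon> > 0\<close> by simp
    next
      case False
      then have "ln (real (max_moves k)) \<le> 2 * real K ^ 3 / (exp 1 * (real K - 1)) + ln (4 * real K ^ 3)"
        using ln_move_counts_le max_moves_mem K by auto
      also have "\<dots> \<le> (2 / exp 1 + \<epsilon>) * (real K)\<^sup>2"
        using X[OF KX] K(1) by (simp add: pos_divide_less_eq)
      finally show ?thesis using K(2) by simp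
    qed
  qed
qed (rule finite_move_counts)

end
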